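(* Let $G$ be a Young function satisfying (growth) and let $M,N$ satisfy (M1), (M2), (M3) and (M4). Then for every sequence $\{u_k\}_{k\in\mathbb{N}}\subset W^{M,N,G}(\mathbb{R}^n)$ that is bounded in the sense that $$\sup_{k\in\mathbb{N}}\big(\Phi_{M,N,G}(u_k)+\Phi_G(u_k)\big)<\infty,$$ there exist $u\in W^{M,N,G}(\mathbb{R}^n)$ and a subsequence $\{u_{k_j}\}_{j\in\mathbb{N}}$ such that $u_{k_j}\to u$ in $L^G_{\mathrm{loc}}(\mathbb{R}^n)$ (that is, in $L^G(K)$ for every compact $K\subset\mathbb{R}^n$).
   Context: A Young function is a function $G:\mathbb{R}\to\mathbb{R}$ that is even, continuous, convex, increasing for $t>0$, with $G(0)=0$, $\lim_{x\to 0}G(x)/x=0$ and $\lim_{x\to\infty}G(x)/x=\infty$. Write $g=G'$. It is normalized by $G(1)=1$. (growth): there are constants $p^-,p^+$ with $1<p^-\le \frac{t g(t)}{G(t)}\le p^+$ for all $t>0$. $M,N:\mathbb{R}_+\to\mathbb{R}_+$ (with $\mathbb{R}_+=[0,\infty)$) satisfy: (M1) $M$ and $N$ are nondecreasing and $M(r),N(r)>0$ for $r>0$; (M2) $M(r)\ge\min\{1,r\}$ and $N$ is continuous; (M3) $\int_0^1 \frac{r^{n-1+p^-}}{N(r)M(r)^{p^-}}\,dr<\infty$ and $\int_1^\infty \frac{r^{n-1}}{N(r)M(r)^{p^-}}\,dr<\infty$; (M4) $\lim_{r\to0}\frac{N(2r)M(2r)^{p^-}}{r^n}=0$. Modulars: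 $\Phi_G(u)=\int_{\mathbb{R}^n}G(u(x))\,dx$ and $\Phi_{M,N,G}(u)=\int_{\mathbb{R}^{2n}}G\left(\frac{u(x)-u(y)}{M(|x-y|)}\right)\frac{dx\,dy}{N(|x-y|)}$. Spaces: $L^G(\mathbb{R}^n)=\{u:\mathbb{R}^n\to\mathbb{R}\text{ measurable}: \Phi_G(u)<\infty\}$ and $W^{M,N,G}(\mathbb{R}^n)=\{u\in L^G(\mathbb{R}^n):\Phi_{M,N,G}(u)<\infty\}$. The space $L^G(K)$ carries the Luxemburg norm $\inf\{\lambda>0:\int_K G(u/\lambda)\,dx\le1\}$. *)

theory Defs
  imports "HOL-Analysis.Analysis"
begin

definition young_function :: "(real \<Rightarrow> real) \<Rightarrow> bool" where
  "young_function G \<longleftrightarrow>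
     (\<forall>x. G (- x) = G x) \<and>
     continuous_on UNIV G \<and>
     convex_on UNIV G \<and>
     strict_mono_on {0<..} G \<and>
     G 0 = 0 \<and>
     ((\<lambda>x. G x / x) \<longlongrightarrow> 0) (at 0) \<and>
     filterlim (\<lambda>x. G x / x) at_top at_top \<and>
     G 1 = 1"

text \<open>
  The derivative \<open>g = G'\<close> is \<^term>\<open>deriv G\<close>; as \<^const>\<open>deriv\<close> is total, the existence of
  \<open>g t\<close> is required explicitly.
\<close>

definition growth_condition :: "(real \<Rightarrow> real) \<Rightarrow> real \<Rightarrow> real \<Rightarrow> bool" where
  "growth_condition G pm pp \<longleftrightarrow>
     1 < pm \<and>
     (\<forall>t>0. G differentiable (at t) \<and>
            pm \<le> t * deriv G t / G t \<and> t * deriv G t / G t \<le> pp)"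

text \<open>
  Functions on \<open>[0,\<infinity>)\<close> are represented by functions on the reals of which only the values
  on \<^term>\<open>{0..} :: real set\<close> matter.
\<close>

definition cond_M1 :: "(real \<Rightarrow> real) \<Rightarrow> (real \<Rightarrow> real) \<Rightarrow> bool" where
  "cond_M1 M N \<longleftrightarrow>
     mono_on {0..} M \<and> mono_on {0..} N \<and> (\<forall>r>0. M r > 0 \<and> N r > 0)"

definition cond_M2 :: "(real \<Rightarrow> real) \<Rightarrow> (real \<Rightarrow> real) \<Rightarrow> bool" where
  "cond_M2 M N \<longleftrightarrow> (\<forall>r\<ge>0. M r \<ge> min 1 r) \<and> continuous_on {0..} N"

definition cond_M3 :: "nat \<Rightarrow> real \<Rightarrow> (real \<Rightarrow> real) \<Rightarrow> (real \<Rightarrow> real) \<Rightarrow> bool" where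
  "cond_M3 n pm M N \<longleftrightarrow>
     (\<integral>\<^sup>+ r\<in>{0<..1}. ennreal (r powr (real n - 1 + pm) / (N r * M r powr pm)) \<partial>lebesgue) < \<infinity> \<and>
     (\<integral>\<^sup>+ r\<in>{1..}. ennreal (r powr (real n - 1) / (N r * M r powr pm)) \<partial>lebesgue) < \<infinity>"

definition cond_M4 :: "nat \<Rightarrow> real \<Rightarrow> (real \<Rightarrow> real) \<Rightarrow> (real \<Rightarrow> real) \<Rightarrow> bool" where
  "cond_M4 n pm M N \<longleftrightarrow>
     ((\<lambda>r. N (2 * r) * M (2 * r) powr pm / r ^ n) \<longlongrightarrow> 0) (at_right 0)"

text \<open>
  \<open>\<Phi>\<^sub>G\<close>, localised to a set \<open>A\<close>; the modular of the space on the whole of \<open>\<real>\<^sup>n\<close> is the case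
  \<^term>\<open>A = UNIV\<close>.
\<close>

definition modular_G :: "(real \<Rightarrow> real) \<Rightarrow> (real ^ 'n) set \<Rightarrow> (real ^ 'n \<Rightarrow> real) \<Rightarrow> ennreal" where
  "modular_G G A u = (\<integral>\<^sup>+ x\<in>A. ennreal (G (u x)) \<partial>lebesgue)"

text \<open>
  The integral is with respect to Lebesgue measure on \<open>\<real>\<^sup>n \<times> \<real>\<^sup>n\<close>. On the diagonal, where
  \<open>M 0\<close> or \<open>N 0\<close> may vanish, the quotients have HOL's conventional value \<open>0\<close>; the diagonal is
  a null set.
\<close>

definition modular_MNG ::
    "(real \<Rightarrow> real) \<Rightarrow> (real \<Rightarrow> real) \<Rightarrow> (real \<Rightarrow> real) \<Rightarrow> (real ^ 'n \<Rightarrow> real) \<Rightarrow> ennreal" where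
  "modular_MNG M N G u =
     (\<integral>\<^sup>+ (x, y). ennreal (G ((u x - u y) / M (norm (x - y))) / N (norm (x - y))) \<partial>lebesgue)"

definition orlicz_space :: "(real \<Rightarrow> real) \<Rightarrow> (real ^ 'n \<Rightarrow> real) set" where
  "orlicz_space G = {u \<in> borel_measurable lebesgue. modular_G G UNIV u < \<infinity>}"

definition W_space ::
    "(real \<Rightarrow> real) \<Rightarrow> (real \<Rightarrow> real) \<Rightarrow> (real \<Rightarrow> real) \<Rightarrow> (real ^ 'n \<Rightarrow> real) set" where
  "W_space M N G = {u \<in> orlicz_space G. modular_MNG M N G u < \<infinity>}"

text \<open>
  The infimum is taken in \<^typ>\<open>ennreal\<close>, so that the norm of a function outside \<open>L\<^sup>G(K)\<close> is
  \<open>\<infinity>\<close> and not an unspecified real number.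
\<close>

definition luxemburg_norm :: "(real \<Rightarrow> real) \<Rightarrow> (real ^ 'n) set \<Rightarrow> (real ^ 'n \<Rightarrow> real) \<Rightarrow> ennreal" where
  "luxemburg_norm G K u =
     (INF l \<in> {l::real. l > 0 \<and> modular_G G K (\<lambda>x. u x / l) \<le> 1}. ennreal l)"

end

theory Submission
  imports Defs "HOL-Complex_Analysis.Great_Picard" "HOL-Real_Asymp.Real_Asymp"
begin

text \<open>
  The proof is a discrete version of the Riesz-Kolmogorov compactness argument. A bound on the
  nonlocal modular forces \<open>u\<close> to be close, in the modular of \<open>G\<close>, to a step function on a grid of
  cubes of side \<open>h\<close>. Indeed, for points \<open>x\<close>, \<open>y\<close> of one cube the scaling of \<open>G\<close> bounds
  \<open>G(u(x) - u(y))\<close> by \<open>N M\<^sup>p\<close> (with \<open>p = pm\<close>) times the integrand of the nonlocal modular, and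
  averaging over a cube divides by \<open>h\<^sup>n\<close>. The resulting error is of the order of
  \<open>N(\<rho>) M(\<rho>)\<^sup>p / \<rho>\<^sup>n\<close> with \<open>\<rho> = n h\<close>, uniformly over the bounded sequence
  (\<open>exists_representatives\<close>), and tends to \<open>0\<close> with \<open>h\<close> by \<open>cond_M4\<close>.

  At each mesh a bounded region sees finitely many step values, and these are bounded. A diagonal
  subsequence makes all of them converge, so the functions themselves form a Cauchy sequence for
  the modular on every bounded set (\<open>exists_Cauchy_subseq\<close>). A further subsequence converges
  almost everywhere (\<open>Cauchy_imp_AE_convergent_subseq\<close>), and Fatou's lemma puts the limit into
  the space and yields convergence in the Luxemburg norm (\<open>compact_embedding_Borel\<close>).

  These steps use Tonelli's theorem and are carried out for Borel functions. A Lebesgue measurable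
  function agrees almost everywhere with a Borel one, and neither modular sees the difference.
\<close>

section \<open>Growth of Young functions\<close>

locale young_growth =
  fixes G :: "real \<Rightarrow> real" and pm pp :: real
  assumes young: "young_function G"
    and growth: "growth_condition G pm pp"
begin

lemma G_even: "G (- x) = G x"
  and G_continuous: "continuous_on UNIV G"
  and G_convex: "convex_on UNIV G"
  and G_strict_mono: "strict_mono_on {0<..} G"
  and G_zero [simp]: "G 0 = 0"
  and G_one [simp]: "G 1 = 1"
  using young unfolding young_function_def by auto

lemma G_measurable [measurable]: "G \<in> borel_measurable borel"
  using G_continuous by (rule borel_measurable_continuous_onI)

lemma G_midpoint_le: "G ((a + b) / 2) \<le> (G a + G b) / 2"
proof -
  have "G ((1 - 1/2) *\<^sub>R a + (1/2) *\<^sub>R b) \<le> (1 - 1/2) * G a + (1/2) * G b"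
    by (rule convex_onD[OF G_convex]) auto
  then show ?thesis by (simp add: field_simps)
qed

lemma G_nonneg [simp]: "0 \<le> G x"
  using G_midpoint_le[of x "-x"] by (simp add: G_even)

lemma G_abs [simp]: "G \<bar>x\<bar> = G x"
  by (simp add: abs_if G_even)

lemma G_positive: "x \<noteq> 0 \<Longrightarrow> 0 < G x"
proof -
  assume "x \<noteq> 0"
  then have "G (\<bar>x\<bar> / 2) < G \<bar>x\<bar>"
    by (intro strict_mono_onD[OF G_strict_mono]) auto
  then show ?thesis using G_nonneg[of "\<bar>x\<bar> / 2"] by (simp del: G_nonneg)
qed

lemma G_mono_abs: "\<bar>a\<bar> \<le> \<bar>b\<bar> \<Longrightarrow> G a \<le> G b"
proof -
  assume ab: "\<bar>a\<bar> \<le> \<bar>b\<bar>"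
  have "G \<bar>a\<bar> \<le> G \<bar>b\<bar>"
  proof (cases "a = 0")
    case False
    then have "\<bar>a\<bar> \<in> {0<..}" "\<bar>b\<bar> \<in> {0<..}" using ab by auto
    then show ?thesis using ab G_strict_mono by (metis strict_mono_on_leD)
  qed simp
  then show ?thesis by simp
qed

lemma exponents: "1 < pm" "pm \<le> pp"
proof -
  show "1 < pm" using growth by (auto simp: growth_condition_def)
  have "pm \<le> 1 * deriv G 1 / G 1" "1 * deriv G 1 / G 1 \<le> pp"
    using growth zero_less_one unfolding growth_condition_def by blast+
  then show "pm \<le> pp" by linarith
qed

lemma G_has_derivative:
  assumes "0 < t"
  obtains g where "(G has_real_derivative g) (at t)" "pm * G t \<le> t * g" "t * g \<le> pp * G t"
proof
  have *: "G differentiable (at t)" "pm \<le> t * deriv G t / G t" "t * deriv G t / G t \<le> pp"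
    using growth assms by (auto simp: growth_condition_def)
  show "(G has_real_derivative deriv G t) (at t)"
    using *(1) by (simp add: DERIV_deriv_iff_real_differentiable)
  have "0 < G t" using assms G_positive by simp
  then show "pm * G t \<le> t * deriv G t" "t * deriv G t \<le> pp * G t"
    using *(2,3) by (simp_all add: field_simps)
qed

lemma power_quotient_derivative:
  assumes "0 < t" "(G has_real_derivative g) (at t)"
  shows "((\<lambda>t. G t * t powr - p) has_real_derivative t powr (- p - 1) * (t * g - p * G t)) (at t)"
proof -
  have "((\<lambda>t. G t * t powr - p) has_real_derivative g * t powr - p + (- p * t powr (- p - 1)) * G t) (at t)"
    by (rule DERIV_mult assms has_real_derivative_powr)+
  moreover have "t powr - p = t powr (- p - 1) * t"
    using assms(1) by (simp add: powr_diff)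
  ultimately show ?thesis by (simp add: algebra_simps)
qed

text \<open>
  The growth condition compares the logarithmic derivative \<open>t g(t) / G(t)\<close> with those of the powers
  \<open>t\<^sup>p\<close> for \<open>p = pm\<close> and \<open>p = pp\<close>, so \<open>G(t) / t\<^sup>p\<close> is nondecreasing for the first exponent and
  nonincreasing for the second. Differentiability enters only here: every later estimate goes
  through the resulting scaling inequalities.
\<close>

lemma scale_powr_pos:
  assumes "0 < t" "t \<le> s"
  shows "G t * t powr - pm \<le> G s * s powr - pm" "G s * s powr - pp \<le> G t * t powr - pp"
proof -
  show "G t * t powr - pm \<le> G s * s powr - pm"
  proof (rule DERIV_nonneg_imp_nondecreasing[OF assms(2), where f = "\<lambda>t. G t * t powr - pm"])
    fix x assume "t \<le> x" "x \<le> s"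
    then have x: "0 < x" using assms by simp
    obtain g where g: "(G has_real_derivative g) (at x)" "pm * G x \<le> x * g"
      using G_has_derivative[OF x] by metis
    show "\<exists>y. ((\<lambda>t. G t * t powr - pm) has_real_derivative y) (at x) \<and> 0 \<le> y"
      using power_quotient_derivative[OF x g(1), of pm] g(2) by (intro exI conjI) auto
  qed
  show "G s * s powr - pp \<le> G t * t powr - pp"
  proof (rule DERIV_nonpos_imp_nonincreasing[OF assms(2), where f = "\<lambda>t. G t * t powr - pp"])
    fix x assume "t \<le> x" "x \<le> s"
    then have x: "0 < x" using assms by simp
    obtain g where g: "(G has_real_derivative g) (at x)" "x * g \<le> pp * G x"
      using G_has_derivative[OF x] by metis
    show "\<exists>y. ((\<lambda>t. G t * t powr - pp) has_real_derivative y) (at x) \<and> y \<le> 0"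
      using power_quotient_derivative[OF x g(1), of pp] g(2)
      by (intro exI conjI) (auto intro!: mult_nonneg_nonpos)
  qed
qed

lemma G_scale_up:
  assumes "1 \<le> c"
  shows "G (c * t) \<le> c powr pp * G t"
proof (cases "t = 0")
  case False
  then have "0 < \<bar>t\<bar>" "\<bar>t\<bar> \<le> c * \<bar>t\<bar>" using assms by (auto simp: mult_le_cancel_right1)
  from scale_powr_pos(2)[OF this] False assms
  have "G (c * \<bar>t\<bar>) \<le> c powr pp * G \<bar>t\<bar>"
    by (simp add: powr_minus powr_mult field_simps)
  moreover have "G (c * \<bar>t\<bar>) = G (c * t)"
    using assms G_abs[of "c * t"] by (simp add: abs_mult)
  ultimately show ?thesis by simp
qed simp

lemma G_scale_down:
  assumes "0 \<le> c" "c \<le> 1"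
  shows "G (c * t) \<le> c powr pm * G t"
proof (cases "t = 0 \<or> c = 0")
  case False
  then have "0 < c * \<bar>t\<bar>" "c * \<bar>t\<bar> \<le> \<bar>t\<bar>" using assms by (auto simp: mult_left_le_one_le)
  from scale_powr_pos(1)[OF this] False assms
  have "G (c * \<bar>t\<bar>) \<le> c powr pm * G \<bar>t\<bar>"
    by (simp add: powr_minus powr_mult field_simps)
  moreover have "G (c * \<bar>t\<bar>) = G (c * t)"
    using assms G_abs[of "c * t"] by (simp add: abs_mult)
  ultimately show ?thesis by simp
qed auto

text \<open>
  Multiplication by \<open>c = M(r)\<close> costs the factor \<open>c\<^sup>p\<close> with \<open>p = pm\<close> only for \<open>c \<le> 1\<close>, whereas the
  smallness hypothesis on \<open>N M\<^sup>p\<close> at the origin is stated with \<open>pm\<close> and leaves room for \<open>M > 1\<close>. For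
  \<open>c\<close> in a bounded range the larger exponent \<open>pp\<close> may be traded for a constant.
\<close>

lemma G_scale_bounded:
  assumes "0 \<le> c" "c \<le> b" "1 \<le> b"
  shows "G (c * t) \<le> b powr (pp - pm) * c powr pm * G t"
proof (cases "c \<le> 1")
  case True
  have "1 \<le> b powr (pp - pm)"
    using assms exponents by (intro ge_one_powr_ge_zero) auto
  then have "1 * (c powr pm * G t) \<le> b powr (pp - pm) * (c powr pm * G t)"
    by (intro mult_right_mono) auto
  then show ?thesis using G_scale_down[OF assms(1) True, of t] by (simp add: mult.assoc)
next
  case False
  have "c powr pp = c powr (pp - pm) * c powr pm" by (simp add: powr_add[symmetric])
  also have "\<dots> \<le> b powr (pp - pm) * c powr pm"
    using False assms exponents by (intro mult_right_mono powr_mono2) auto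
  finally have "c powr pp * G t \<le> b powr (pp - pm) * c powr pm * G t"
    by (intro mult_right_mono) auto
  then show ?thesis using G_scale_up[of c t] False by simp
qed

text \<open>
  The quasi-triangle inequality: convexity at the midpoint, then doubling.
\<close>

lemma G_add_le: "G (a + b) \<le> 2 powr pp * (G a + G b)"
proof -
  have "G (a + b) \<le> (G (2 * a) + G (2 * b)) / 2"
  proof -
    have "(2 * a + 2 * b) / 2 = a + b" by simp
    then show ?thesis using G_midpoint_le[of "2 * a" "2 * b"] by metis
  qed
  also have "\<dots> \<le> (2 powr pp * G a + 2 powr pp * G b) / 2"
    using G_scale_up[of 2 a] G_scale_up[of 2 b] by simp
  also have "\<dots> \<le> 2 powr pp * (G a + G b)" by (simp add: field_simps)
  finally show ?thesis .
qed

lemma abs_le_G: "\<bar>t\<bar> \<le> 1 + G t"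
proof (cases "\<bar>t\<bar> \<le> 1")
  case False
  have "G (inverse \<bar>t\<bar> * \<bar>t\<bar>) \<le> inverse \<bar>t\<bar> powr pm * G \<bar>t\<bar>"
    using False by (intro G_scale_down) (auto simp: field_simps)
  also have "inverse \<bar>t\<bar> * \<bar>t\<bar> = 1" using False by (cases "t = 0") auto
  also have "inverse \<bar>t\<bar> powr pm * G \<bar>t\<bar> \<le> inverse \<bar>t\<bar> powr 1 * G \<bar>t\<bar>"
    using False exponents by (intro mult_right_mono powr_mono') (auto simp: field_simps)
  finally have "1 \<le> inverse \<bar>t\<bar> * G t"
    using False by (simp del: mult_eq_0_iff)
  then have "\<bar>t\<bar> \<le> G t" using False by (simp add: field_simps)
  then show ?thesis by simp
qed (use G_nonneg[of t] in linarith)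

end

section \<open>A grid of cubes\<close>

text \<open>
  The half-open cubes of side \<open>h\<close> are indexed by functions into the integers rather than by integer
  vectors: on a finite domain these form a countable type, which the diagonal argument needs.
\<close>

definition cell :: "real \<Rightarrow> ('n \<Rightarrow> int) \<Rightarrow> (real ^ 'n) set" where
  "cell h z = {x. \<forall>i. \<lfloor>x $ i / h\<rfloor> = z i}"

lemma cell_sets [measurable]: "cell h z \<in> sets borel"
  unfolding cell_def by measurable

lemma cell_disjoint: "x \<in> cell h z \<Longrightarrow> x \<in> cell h z' \<longleftrightarrow> z = z'"
  by (auto simp: cell_def)

lemma mem_own_cell: "x \<in> cell h (\<lambda>i. \<lfloor>x $ i / h\<rfloor>)"
  by (simp add: cell_def)

lemma mem_cell_iff:
  assumes "0 < h"
  shows "x \<in> cell h z \<longleftrightarrow> (\<forall>i. h * real_of_int (z i) \<le> x $ i \<and> x $ i < h * (real_of_int (z i) + 1))"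
  using assms by (simp add: cell_def floor_eq_iff pos_le_divide_eq pos_divide_less_eq mult.commute)

lemma emeasure_cell:
  assumes "0 < h"
  shows "emeasure lborel (cell h z :: (real ^ 'n) set) = ennreal (h ^ CARD('n))"
proof -
  define a b :: "real ^ 'n"
    where "a = (\<chi> i. h * real_of_int (z i))" and "b = (\<chi> i. h * (real_of_int (z i) + 1))"
  have ab: "a $ i \<le> b $ i" "b $ i - a $ i = h" for i
    using assms by (simp_all add: a_def b_def algebra_simps)
  have le: "\<And>k. k \<in> Basis \<Longrightarrow> a \<bullet> k \<le> b \<bullet> k"
    using ab by (auto simp: Basis_vec_def cart_eq_inner_axis[symmetric] inner_commute)
  have ne: "cbox a b \<noteq> {}"
    using ab by (simp add: interval_ne_empty_cart)
  have "measure lborel (cbox a b) = (\<Prod>i\<in>UNIV. b $ i - a $ i)"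
    by (rule content_cbox_cart[OF ne])
  then have c: "measure lborel (cbox a b) = h ^ CARD('n)"
    by (simp add: ab)
  have *: "emeasure lborel (cbox a b) = ennreal (h ^ CARD('n))"
    using c emeasure_lborel_cbox_finite[of a b] by (simp add: emeasure_eq_ennreal_measure)
  have "box a b \<subseteq> cell h z" "cell h z \<subseteq> cbox a b"
    unfolding subset_iff mem_cell_iff[OF assms] mem_box_cart a_def b_def vec_lambda_beta
    by (meson less_imp_le)+
  then have "emeasure lborel (box a b) \<le> emeasure lborel (cell h z)"
    "emeasure lborel (cell h z) \<le> emeasure lborel (cbox a b)"
    by (auto intro!: emeasure_mono)
  moreover have "emeasure lborel (box a b) = emeasure lborel (cbox a b)"
    using le by (simp add: emeasure_lborel_box emeasure_lborel_cbox)
  ultimately show ?thesis using * by simp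
qed

lemma cell_diameter:
  fixes x y :: "real ^ 'n"
  assumes "0 < h" "x \<in> cell h z" "y \<in> cell h z"
  shows "norm (x - y) \<le> real CARD('n) * h"
proof -
  have "norm (x - y) \<le> (\<Sum>i\<in>UNIV. \<bar>(x - y) $ i\<bar>)" by (rule norm_le_l1_cart)
  also have "\<dots> \<le> (\<Sum>i\<in>(UNIV :: 'n set). h)"
  proof (rule sum_mono)
    fix i
    have "h * real_of_int (z i) \<le> x $ i" "x $ i < h * real_of_int (z i) + h"
      "h * real_of_int (z i) \<le> y $ i" "y $ i < h * real_of_int (z i) + h"
      using assms by (auto simp: mem_cell_iff algebra_simps)
    then show "\<bar>(x - y) $ i\<bar> \<le> h" by simp
  qed
  finally show ?thesis by simp
qed

lemma finite_cells_meeting_bounded: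
  fixes K :: "(real ^ 'n) set"
  assumes "bounded K" "0 < h"
  shows "finite {z. cell h z \<inter> K \<noteq> {}}"
proof -
  obtain B where B: "\<And>x. x \<in> K \<Longrightarrow> norm x \<le> B" using assms by (auto simp: bounded_iff)
  have "{z. cell h z \<inter> K \<noteq> {}} \<subseteq> (\<Pi>\<^sub>E i\<in>UNIV. {\<lfloor>- (B / h)\<rfloor>..\<lfloor>B / h\<rfloor>})"
  proof
    fix z assume "z \<in> {z. cell h z \<inter> K \<noteq> {}}"
    then obtain x where x: "x \<in> K" "\<And>i. \<lfloor>x $ i / h\<rfloor> = z i"
      by (auto simp: cell_def)
    have "z i \<in> {\<lfloor>- (B / h)\<rfloor>..\<lfloor>B / h\<rfloor>}" for i
    proof -
      have "\<bar>x $ i\<bar> \<le> B" using B[OF x(1)] component_le_norm_cart[of x i] by linarith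
      then have "- (B / h) \<le> x $ i / h" "x $ i / h \<le> B / h"
        using assms(2) by (auto simp: field_simps abs_le_iff)
      then show ?thesis
        using floor_mono[of _ "x $ i / h"] floor_mono[of "x $ i / h"] x(2)[of i] by auto
    qed
    then show "z \<in> (\<Pi>\<^sub>E i\<in>UNIV. {\<lfloor>- (B / h)\<rfloor>..\<lfloor>B / h\<rfloor>})"
      by (simp add: PiE_iff)
  qed
  then show ?thesis by (rule finite_subset) (auto intro!: finite_PiE)
qed

section \<open>Tools from measure theory\<close>

text \<open>
  If \<open>F\<close> exceeded its average everywhere on \<open>Q\<close>, integrating over \<open>Q\<close> would give a strict inequality
  between the integral of \<open>F\<close> and itself.
\<close>

lemma exists_le_average:
  fixes F :: "'a \<Rightarrow> ennreal"
  assumes [measurable]: "F \<in> borel_measurable M" "Q \<in> sets M"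
    and Q: "emeasure M Q \<noteq> 0" "emeasure M Q \<noteq> \<infinity>"
  shows "\<exists>y\<in>Q. emeasure M Q * F y \<le> (\<integral>\<^sup>+ y\<in>Q. F y \<partial>M)"
proof (rule ccontr)
  define I where "I = (\<integral>\<^sup>+ y\<in>Q. F y \<partial>M)"
  assume "\<not> ?thesis"
  then have less: "\<And>y. y \<in> Q \<Longrightarrow> I < emeasure M Q * F y" by (auto simp: I_def not_le)
  have "Q \<noteq> {}" using Q by auto
  then have I: "I \<noteq> \<infinity>" using less by (metis all_not_in_conv infinity_ennreal_def top.not_eq_extremum order_less_le_trans top_greatest)
  define f where "f = (\<lambda>y. I * indicator Q y)"
  have [measurable]: "f \<in> borel_measurable M" unfolding f_def by measurable
  have f: "(\<integral>\<^sup>+ y. f y \<partial>M) = I * emeasure M Q"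
    unfolding f_def by (simp add: nn_integral_cmult)
  have "(\<integral>\<^sup>+ y. f y \<partial>M) < (\<integral>\<^sup>+ y. emeasure M Q * (F y * indicator Q y) \<partial>M)"
  proof (rule nn_integral_less)
    show "(\<integral>\<^sup>+ y. f y \<partial>M) \<noteq> \<infinity>"
      using I Q by (simp add: f ennreal_mult_eq_top_iff)
    show "AE y in M. f y \<le> emeasure M Q * (F y * indicator Q y)"
      using less by (intro AE_I2) (auto simp: f_def indicator_def less_imp_le)
    show "\<not> (AE y in M. emeasure M Q * (F y * indicator Q y) \<le> f y)"
    proof
      assume "AE y in M. emeasure M Q * (F y * indicator Q y) \<le> f y"
      then have "AE y in M. y \<notin> Q"
        by eventually_elim (use less in \<open>force simp: f_def indicator_def not_le\<close>)
      then show False using Q by (simp add: AE_iff_measurable[OF assms(2)] AE_iff_null_sets[symmetric] null_sets_def)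
    qed
  qed auto
  also have "\<dots> = emeasure M Q * I" by (simp add: nn_integral_cmult I_def)
  finally show False using f by (simp add: mult.commute)
qed

lemma modular_G_lborel:
  "modular_G G A u = (\<integral>\<^sup>+ x\<in>A. ennreal (G (u x)) \<partial>lborel)"
  by (simp add: modular_G_def nn_integral_completion)

lemma modular_MNG_lborel:
  "modular_MNG M N G u =
    (\<integral>\<^sup>+ p. ennreal (G ((u (fst p) - u (snd p)) / M (norm (fst p - snd p))) / N (norm (fst p - snd p)))
      \<partial>(lborel \<Otimes>\<^sub>M lborel))"
  by (simp add: modular_MNG_def nn_integral_completion lborel_prod case_prod_beta')

text \<open>
  Monotonicity on \<open>[0,\<infinity>)\<close> suffices because the truncation \<open>r \<longmapsto> M (max 0 r)\<close> is monotone on the whole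
  line and agrees with \<open>M\<close> on norms.
\<close>

lemma borel_measurable_mono_norm:
  fixes f :: "'a \<Rightarrow> 'b :: {second_countable_topology, real_normed_vector}" and M :: "real \<Rightarrow> real"
  assumes "mono_on {0..} M" "f \<in> borel_measurable S"
  shows "(\<lambda>x. M (norm (f x))) \<in> borel_measurable S"
proof -
  have "mono (\<lambda>r. M (max 0 r))"
    using assms(1) by (auto intro!: monoI mono_onD[OF assms(1)])
  then have [measurable]: "(\<lambda>r. M (max 0 r)) \<in> borel_measurable borel"
    by (rule borel_measurable_mono)
  note assms(2)[measurable]
  have "(\<lambda>x. M (max 0 (norm (f x)))) \<in> borel_measurable S"
    by measurable
  then show ?thesis by simp
qed

lemma AE_pair_both:
  assumes "sigma_finite_measure S" "AE x in S. P x"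
  shows "AE p in S \<Otimes>\<^sub>M S. P (fst p) \<and> P (snd p)"
proof -
  interpret sigma_finite_measure S by fact
  obtain X where X: "{x \<in> space S. \<not> P x} \<subseteq> X" "emeasure S X = 0" "X \<in> sets S"
    using assms(2) by (rule AE_E)
  have "X \<times> space S \<union> space S \<times> X \<in> null_sets (S \<Otimes>\<^sub>M S)"
    using X(2,3) by (intro null_sets.Un) (auto simp: null_sets_def emeasure_pair_measure_Times)
  then show ?thesis
    by (rule AE_I') (use X(1) in \<open>auto simp: space_pair_measure\<close>)
qed

text \<open>
  Fatou's lemma, in the form in which bounds on modulars pass to almost everywhere limits.
\<close>

lemma nn_integral_le_of_AE_tendsto:
  fixes f :: "nat \<Rightarrow> 'a \<Rightarrow> ennreal"
  assumes [measurable]: "\<And>i. f i \<in> borel_measurable S"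
    and lim: "AE x in S. (\<lambda>i. f i x) \<longlonglongrightarrow> g x"
    and le: "\<forall>\<^sub>F i in sequentially. (\<integral>\<^sup>+ x. f i x \<partial>S) \<le> b"
  shows "(\<integral>\<^sup>+ x. g x \<partial>S) \<le> b"
proof -
  have "(\<integral>\<^sup>+ x. g x \<partial>S) = (\<integral>\<^sup>+ x. liminf (\<lambda>i. f i x) \<partial>S)"
    using lim by (intro nn_integral_cong_AE) (auto elim!: eventually_mono simp: lim_imp_Liminf)
  also have "\<dots> \<le> liminf (\<lambda>i. \<integral>\<^sup>+ x. f i x \<partial>S)"
    by (rule nn_integral_liminf) simp
  also have "\<dots> \<le> limsup (\<lambda>i. \<integral>\<^sup>+ x. f i x \<partial>S)"
    by (rule Liminf_le_Limsup) simp
  also have "\<dots> \<le> b" using le by (rule Limsup_bounded)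
  finally show ?thesis .
qed

lemma exists_strict_mono_above:
  fixes f :: "nat \<Rightarrow> nat"
  shows "\<exists>s :: nat \<Rightarrow> nat. strict_mono s \<and> (\<forall>j. f j \<le> s j)"
proof (intro exI conjI allI)
  show "strict_mono (\<lambda>j. \<Sum>i\<le>j. Suc (f i))" by (intro strict_monoI_Suc) simp
  show "f j \<le> (\<Sum>i\<le>j. Suc (f i))" for j
    using member_le_sum[of j "{..j}" "\<lambda>i. Suc (f i)"] by simp
qed

context young_growth
begin

section \<open>Approximation by step functions\<close>

text \<open>
  This is the quantitative heart of the compactness. On a cell \<open>Q\<close> of side \<open>h\<close> put
  \<open>F(y) = \<integral>\<^sub>Q G(u(x) - u(y)) dx\<close>. Some \<open>y \<in> Q\<close> satisfies \<open>h\<^sup>n F(y) \<le> \<integral>\<^sub>Q F\<close>, and \<open>c = u(y)\<close> is taken as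
  the value of a step function on \<open>Q\<close>. Using a value of \<open>u\<close> instead of its mean avoids both local
  integrability and Jensen's inequality. Any two points of \<open>Q\<close> are at distance \<open>r \<le> \<rho>\<close>, so
  \<open>G(u(x) - u(y)) \<le> C N(r) M(r)\<^sup>p E(x,y)\<close>, where \<open>p = pm\<close> and \<open>E\<close> is the integrand of the modular
  \<open>modular_MNG\<close>, and monotonicity replaces \<open>r\<close> by \<open>\<rho>\<close>. As the squares \<open>Q \<times> Q\<close> are disjoint, summing
  over cells costs no more than one modular. The constants \<open>c\<close> serve all finite sets of cells at once.
\<close>

lemma exists_representatives:
  fixes u :: "real ^ 'n \<Rightarrow> real"
  assumes u [measurable]: "u \<in> borel_measurable borel"
    and mono: "mono_on {0..} M" "mono_on {0..} N"
    and pos: "\<And>r. 0 < r \<Longrightarrow> 0 < M r \<and> 0 < N r"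
    and h: "0 < h" and \<rho>: "\<rho> = real CARD('n) * h" "\<rho> \<le> 1"
  shows "\<exists>c. \<forall>Z. finite Z \<longrightarrow> (\<Sum>z\<in>Z. modular_G G (cell h z) (\<lambda>x. u x - c z))
     \<le> ennreal (max 1 (M 1) powr (pp - pm) * (N \<rho> * M \<rho> powr pm / h ^ CARD('n))) * modular_MNG M N G u"
proof -
  define A where "A = max 1 (M 1) powr (pp - pm) * (N \<rho> * M \<rho> powr pm)"
  define V where "V = h ^ CARD('n)"
  define F where "F z y = (\<integral>\<^sup>+ x\<in>cell h z. ennreal (G (u x - u y)) \<partial>lborel)" for z and y :: "real ^ 'n"
  have V: "0 < V" using h by (simp add: V_def)
  have eV: "emeasure lborel (cell h z :: (real ^ 'n) set) = ennreal V" for z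
    using emeasure_cell[OF h] by (simp add: V_def)
  have F [measurable]: "F z \<in> borel_measurable lborel" for z
    unfolding F_def by measurable
  have "\<exists>y\<in>cell h z. ennreal V * F z y \<le> (\<integral>\<^sup>+ y\<in>cell h z. F z y \<partial>lborel)" for z
    using exists_le_average[of "F z" lborel "cell h z"] V by (simp add: eV)
  then obtain y where y: "\<And>z. ennreal V * F z (y z) \<le> (\<integral>\<^sup>+ y\<in>cell h z. F z y \<partial>lborel)"
    by metis
  have \<rho>_pos: "0 < \<rho>" using \<rho>(1) h by simp
  have A: "0 \<le> A" unfolding A_def using pos[OF \<rho>_pos] by simp
  define E where "E p = G ((u (fst p) - u (snd p)) / M (norm (fst p - snd p))) / N (norm (fst p - snd p))"
    for p :: "(real ^ 'n) \<times> (real ^ 'n)"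
  have [measurable]: "(\<lambda>p. M (norm (fst p - snd p))) \<in> borel_measurable (lborel \<Otimes>\<^sub>M lborel :: ((real ^ 'n) \<times> (real ^ 'n)) measure)"
    "(\<lambda>p. N (norm (fst p - snd p))) \<in> borel_measurable (lborel \<Otimes>\<^sub>M lborel :: ((real ^ 'n) \<times> (real ^ 'n)) measure)"
    by (rule borel_measurable_mono_norm, rule mono, measurable)+
  have [measurable]: "E \<in> borel_measurable (lborel \<Otimes>\<^sub>M lborel)"
    unfolding E_def by measurable
  have pointwise: "G (u a - u b) \<le> A * E (a, b)" if ab: "a \<in> cell h z" "b \<in> cell h z" for a b z
  proof (cases "a = b")
    case False
    define r where "r = norm (a - b)"
    have r: "0 < r" "r \<le> \<rho>" using False cell_diameter[OF h ab] by (auto simp: r_def \<rho>(1))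
    have le: "M r \<le> M \<rho>" "M r \<le> M 1" "N r \<le> N \<rho>"
      using r \<rho> by (auto intro!: mono_onD[OF mono(1)] mono_onD[OF mono(2)])
    have P: "0 < M r" "0 < N r" using pos r by auto
    have "G (u a - u b) = G (M r * ((u a - u b) / M r))" using P by simp
    also have "\<dots> \<le> max 1 (M 1) powr (pp - pm) * M r powr pm * G ((u a - u b) / M r)"
      using P le by (intro G_scale_bounded) auto
    also have "\<dots> = max 1 (M 1) powr (pp - pm) * (N r * M r powr pm) * E (a, b)"
      using P by (simp add: E_def r_def[symmetric])
    also have "\<dots> \<le> A * E (a, b)"
      unfolding A_def using P le exponents
      by (intro mult_right_mono mult_left_mono mult_mono powr_mono2) (auto simp: E_def r_def[symmetric])
    finally show ?thesis .
  qed (simp add: E_def)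
  have sum_indicators: "(\<Sum>z\<in>Z. indicator (cell h z) b * (indicator (cell h z) a * ennreal (G (u a - u b))))
      \<le> ennreal A * ennreal (E (a, b))" if Z: "finite Z" for Z and a b :: "real ^ 'n"
  proof -
    \<comment> \<open>At most one summand is nonzero: the one for the cell that contains \<open>b\<close>.\<close>
    define z0 where "z0 = (\<lambda>i. \<lfloor>b $ i / h\<rfloor>)"
    have b: "b \<in> cell h z \<longleftrightarrow> z = z0" for z
      using cell_disjoint[OF mem_own_cell[of b h]] by (auto simp: z0_def)
    have "(\<Sum>z\<in>Z. indicator (cell h z) b * (indicator (cell h z) a * ennreal (G (u a - u b))))
      = (\<Sum>z\<in>Z. if z = z0 then indicator (cell h z0) a * ennreal (G (u a - u b)) else 0)"
      by (intro sum.cong) (auto simp: b indicator_def)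
    also have "\<dots> \<le> indicator (cell h z0) a * ennreal (G (u a - u b))"
      using Z by simp
    also have "\<dots> \<le> ennreal A * ennreal (E (a, b))"
      using pointwise[of a z0 b] b[of z0] A by (auto simp: indicator_def ennreal_mult'[symmetric] intro!: ennreal_leI)
    finally show ?thesis .
  qed
  have "(\<Sum>z\<in>Z. modular_G G (cell h z) (\<lambda>x. u x - u (y z))) \<le> ennreal (A / V) * modular_MNG M N G u"
    if Z: "finite Z" for Z
  proof -
    have "ennreal V * (\<Sum>z\<in>Z. F z (y z)) \<le> (\<Sum>z\<in>Z. \<integral>\<^sup>+ b\<in>cell h z. F z b \<partial>lborel)"
      unfolding sum_distrib_left by (intro sum_mono y)
    also have "\<dots> = (\<integral>\<^sup>+ b. (\<integral>\<^sup>+ a. (\<Sum>z\<in>Z. indicator (cell h z) b * (indicator (cell h z) a * ennreal (G (u a - u b)))) \<partial>lborel) \<partial>lborel)"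
      by (simp add: F_def nn_integral_sum nn_integral_cmult mult.commute)
    also have "\<dots> \<le> (\<integral>\<^sup>+ b. (\<integral>\<^sup>+ a. ennreal A * ennreal (E (a, b)) \<partial>lborel) \<partial>lborel)"
      by (intro nn_integral_mono sum_indicators Z)
    also have "\<dots> = (\<integral>\<^sup>+ p. ennreal A * ennreal (E p) \<partial>(lborel \<Otimes>\<^sub>M lborel))"
      by (subst lborel_pair.nn_integral_snd) simp_all
    also have "\<dots> = ennreal A * modular_MNG M N G u"
      by (simp add: nn_integral_cmult modular_MNG_lborel E_def)
    finally have "ennreal (1 / V) * (ennreal V * (\<Sum>z\<in>Z. F z (y z))) \<le> ennreal (1 / V) * (ennreal A * modular_MNG M N G u)"
      by (intro mult_left_mono) auto
    moreover have "ennreal (1 / V) * ennreal V = 1" "ennreal (1 / V) * ennreal A = ennreal (A / V)"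
      using V A by (auto simp: ennreal_mult'[symmetric])
    ultimately have "(\<Sum>z\<in>Z. F z (y z)) \<le> ennreal (A / V) * modular_MNG M N G u"
      by (simp add: mult.assoc[symmetric])
    then show ?thesis by (simp add: modular_G_lborel F_def)
  qed
  then show ?thesis by (auto simp: A_def V_def intro!: exI[of _ "\<lambda>z. u (y z)"])
qed

lemma modular_add_le:
  fixes f g :: "real ^ 'n \<Rightarrow> real"
  assumes [measurable]: "f \<in> borel_measurable borel" "g \<in> borel_measurable borel" "A \<in> sets borel"
  shows "modular_G G A (\<lambda>x. f x + g x) \<le> ennreal (2 powr pp) * (modular_G G A f + modular_G G A g)"
proof -
  have "modular_G G A (\<lambda>x. f x + g x)
      \<le> (\<integral>\<^sup>+ x. ennreal (2 powr pp) * (ennreal (G (f x)) * indicator A x + ennreal (G (g x)) * indicator A x) \<partial>lborel)"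
    unfolding modular_G_lborel
    by (intro nn_integral_mono)
      (auto simp: indicator_def ennreal_mult'[symmetric] ennreal_plus[symmetric] G_add_le
        simp del: ennreal_plus intro!: ennreal_leI)
  then show ?thesis by (simp add: modular_G_lborel nn_integral_cmult nn_integral_add)
qed

lemma modular_le_sum_cells:
  fixes f :: "real ^ 'n \<Rightarrow> real"
  assumes [measurable]: "f \<in> borel_measurable borel"
    and "finite Z" "K \<subseteq> (\<Union>z\<in>Z. cell h z)"
  shows "modular_G G K f \<le> (\<Sum>z\<in>Z. modular_G G (cell h z) f)"
proof -
  have "modular_G G K f \<le> (\<integral>\<^sup>+ x. (\<Sum>z\<in>Z. ennreal (G (f x)) * indicator (cell h z) x) \<partial>lborel)"
    unfolding modular_G_lborel
  proof (intro nn_integral_mono)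
    fix x :: "real ^ 'n"
    show "ennreal (G (f x)) * indicator K x \<le> (\<Sum>z\<in>Z. ennreal (G (f x)) * indicator (cell h z) x)"
    proof (cases "x \<in> K")
      case True
      then obtain z where z: "z \<in> Z" "x \<in> cell h z" using assms(3) by auto
      have "ennreal (G (f x)) * indicator (cell h z) x \<le> (\<Sum>z\<in>Z. ennreal (G (f x)) * indicator (cell h z) x)"
        using z(1) assms(2) by (intro member_le_sum) auto
      then show ?thesis using z True by simp
    qed simp
  qed
  then show ?thesis by (simp add: modular_G_lborel nn_integral_sum)
qed

lemma modular_scale_le:
  fixes f :: "real ^ 'n \<Rightarrow> real"
  assumes [measurable]: "f \<in> borel_measurable borel" "A \<in> sets borel" and c: "1 \<le> c"
  shows "modular_G G A (\<lambda>x. c * f x) \<le> ennreal (c powr pp) * modular_G G A f"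
proof -
  have "modular_G G A (\<lambda>x. c * f x) \<le> (\<integral>\<^sup>+ x. ennreal (c powr pp) * (ennreal (G (f x)) * indicator A x) \<partial>lborel)"
    unfolding modular_G_lborel using c
    by (intro nn_integral_mono) (auto simp: indicator_def ennreal_mult'[symmetric] intro!: ennreal_leI G_scale_up)
  then show ?thesis by (simp add: modular_G_lborel nn_integral_cmult)
qed

lemma modular_Fatou:
  fixes f :: "nat \<Rightarrow> real ^ 'n \<Rightarrow> real"
  assumes [measurable]: "\<And>i. f i \<in> borel_measurable borel" "A \<in> sets borel"
    and lim: "AE x in lborel. (\<lambda>i. f i x) \<longlonglongrightarrow> g x"
    and "\<forall>\<^sub>F i in sequentially. modular_G G A (f i) \<le> b"
  shows "modular_G G A g \<le> b"
  unfolding modular_G_lborel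
proof (rule nn_integral_le_of_AE_tendsto)
  show "AE x in lborel. (\<lambda>i. ennreal (G (f i x)) * indicator A x) \<longlonglongrightarrow> ennreal (G (g x)) * indicator A x"
    using lim
  proof eventually_elim
    case (elim x)
    have "(\<lambda>i. G (f i x)) \<longlonglongrightarrow> G (g x)"
      using continuous_on_tendsto_compose[OF G_continuous elim] by simp
    then show ?case by (cases "x \<in> A") auto
  qed
qed (use assms(4) in \<open>auto simp: modular_G_lborel\<close>)

lemma modular_MNG_Fatou:
  fixes f :: "nat \<Rightarrow> real ^ 'n \<Rightarrow> real"
  assumes [measurable]: "\<And>i. f i \<in> borel_measurable borel"
    and mono: "mono_on {0..} M" "mono_on {0..} N"
    and lim: "AE x in lborel. (\<lambda>i. f i x) \<longlonglongrightarrow> g x"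
    and "\<forall>\<^sub>F i in sequentially. modular_MNG M N G (f i) \<le> b"
  shows "modular_MNG M N G g \<le> b"
  unfolding modular_MNG_lborel
proof (rule nn_integral_le_of_AE_tendsto)
  have [measurable]: "(\<lambda>p. M (norm (fst p - snd p))) \<in> borel_measurable (lborel \<Otimes>\<^sub>M lborel :: ((real ^ 'n) \<times> (real ^ 'n)) measure)"
    "(\<lambda>p. N (norm (fst p - snd p))) \<in> borel_measurable (lborel \<Otimes>\<^sub>M lborel :: ((real ^ 'n) \<times> (real ^ 'n)) measure)"
    by (rule borel_measurable_mono_norm, rule mono, measurable)+
  show "(\<lambda>p. ennreal (G ((f i (fst p) - f i (snd p)) / M (norm (fst p - snd p))) / N (norm (fst p - snd p))))
    \<in> borel_measurable (lborel \<Otimes>\<^sub>M lborel)" for i by measurable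
  have "AE p in lborel \<Otimes>\<^sub>M lborel. (\<lambda>i. f i (fst p)) \<longlonglongrightarrow> g (fst p) \<and> (\<lambda>i. f i (snd p)) \<longlonglongrightarrow> g (snd p)"
    using lim by (intro AE_pair_both) (auto intro: sigma_finite_lborel)
  then show "AE p in lborel \<Otimes>\<^sub>M lborel.
      (\<lambda>i. ennreal (G ((f i (fst p) - f i (snd p)) / M (norm (fst p - snd p))) / N (norm (fst p - snd p))))
      \<longlonglongrightarrow> ennreal (G ((g (fst p) - g (snd p)) / M (norm (fst p - snd p))) / N (norm (fst p - snd p)))"
  proof eventually_elim
    case (elim p)
    then have "(\<lambda>i. (f i (fst p) - f i (snd p)) / M (norm (fst p - snd p)))
        \<longlonglongrightarrow> (g (fst p) - g (snd p)) / M (norm (fst p - snd p))"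
      unfolding divide_inverse by (intro tendsto_intros) auto
    from continuous_on_tendsto_compose[OF G_continuous this]
    show ?case unfolding divide_inverse by (intro tendsto_ennrealI tendsto_intros) auto
  qed
qed (use assms(5) in \<open>auto simp: modular_MNG_lborel\<close>)

section \<open>Almost everywhere convergence of Cauchy sequences\<close>

text \<open>
  The Riesz-Fischer argument: along a fast subsequence the modulars of \<open>2\<^sup>j d\<^sub>j\<close>, with \<open>d\<^sub>j\<close> the \<open>j\<close>-th
  increment, have a finite sum over growing balls. So at almost every point \<open>G(2\<^sup>j d\<^sub>j) < 1\<close>
  eventually, whence \<open>\<bar>d\<^sub>j\<bar> \<le> 2 \<cdot> 2\<^sup>-\<^sup>j\<close> and the telescoping series converges.
\<close>

lemma Cauchy_imp_AE_convergent_subseq: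
  fixes w :: "nat \<Rightarrow> real ^ 'n \<Rightarrow> real"
  assumes w [measurable]: "\<And>i. w i \<in> borel_measurable borel"
    and Cauchy: "\<And>K e. bounded K \<Longrightarrow> 0 < e \<Longrightarrow>
      \<exists>J. \<forall>i\<ge>J. \<forall>j\<ge>J. modular_G G K (\<lambda>x. w i x - w j x) \<le> ennreal e"
  shows "\<exists>s :: nat \<Rightarrow> nat. \<exists>v. strict_mono s \<and> v \<in> borel_measurable borel \<and>
    (AE x in lborel. (\<lambda>i. w (s i) x) \<longlonglongrightarrow> v x)"
proof -
  \<comment> \<open>The factor \<open>(2 ^ j) powr pp\<close> pays for the multiplication of the increments by \<open>2\<^sup>j\<close>.\<close>
  define e where "e j = (1 / 2) ^ j / (2 ^ j) powr pp" for j :: nat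
  have "\<exists>J. \<forall>p\<ge>J. \<forall>q\<ge>J. modular_G G (cball 0 (real j)) (\<lambda>x. w p x - w q x) \<le> ennreal (e j)" for j
    by (intro Cauchy) (auto simp: e_def)
  then obtain J where J: "\<And>j p q. J j \<le> p \<Longrightarrow> J j \<le> q \<Longrightarrow>
      modular_G G (cball 0 (real j)) (\<lambda>x. w p x - w q x) \<le> ennreal (e j)"
    by metis
  obtain s :: "nat \<Rightarrow> nat" where s: "strict_mono s" "\<And>j. J j \<le> s j"
    using exists_strict_mono_above[of J] by auto
  define d where "d j x = w (s (Suc j)) x - w (s j) x" for j x
  have [measurable]: "d j \<in> borel_measurable borel" for j unfolding d_def by measurable
  have d: "modular_G G (cball 0 (real j)) (\<lambda>x. 2 ^ j * d j x) \<le> ennreal ((1 / 2) ^ j)" for j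
  proof -
    have "J j \<le> s (Suc j)" using s(2)[of j] strict_monoD[OF s(1), of j "Suc j"] by linarith
    then have "modular_G G (cball 0 (real j)) (d j) \<le> ennreal (e j)"
      unfolding d_def using s(2) by (intro J)
    then have "ennreal ((2 ^ j) powr pp) * modular_G G (cball 0 (real j)) (d j) \<le> ennreal ((2 ^ j) powr pp) * ennreal (e j)"
      by (rule mult_left_mono) simp
    also have "\<dots> = ennreal ((1 / 2) ^ j)" by (simp add: ennreal_mult'[symmetric] e_def)
    finally show ?thesis
      using modular_scale_le[of "d j" "cball 0 (real j)" "2 ^ j"] by (simp add: order_trans)
  qed
  define a where "a j x = G (2 ^ j * d j x) * indicator (cball 0 (real j)) x" for j x
  have [measurable]: "cball (0 :: real ^ 'n) r \<in> sets borel" for r by simp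
  have [measurable]: "a j \<in> borel_measurable borel" for j unfolding a_def by measurable
  have "(\<integral>\<^sup>+ x. (\<Sum>j. ennreal (a j x)) \<partial>lborel) = (\<Sum>j. \<integral>\<^sup>+ x. ennreal (a j x) \<partial>lborel)"
    by (rule nn_integral_suminf) simp
  also have "\<dots> = (\<Sum>j. modular_G G (cball 0 (real j)) (\<lambda>x. 2 ^ j * d j x))"
    unfolding modular_G_lborel
    by (intro arg_cong[where f = suminf] ext nn_integral_cong) (auto simp: a_def indicator_def)
  also have "\<dots> \<le> (\<Sum>j. ennreal ((1 / 2) ^ j))" by (rule suminf_le[OF d summableI summableI])
  also have "\<dots> < \<infinity>"
    by (subst suminf_ennreal2) (simp_all add: summable_geometric)
  finally have "(\<integral>\<^sup>+ x. (\<Sum>j. ennreal (a j x)) \<partial>lborel) \<noteq> \<infinity>" by simp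
  then have "AE x in lborel. (\<Sum>j. ennreal (a j x)) \<noteq> \<infinity>"
    by (intro nn_integral_PInf_AE) auto
  then have "AE x in lborel. convergent (\<lambda>i. w (s i) x)"
  proof eventually_elim
    case (elim x)
    have "summable (\<lambda>j. a j x)"
      using elim by (intro summable_suminf_not_top) (auto simp: a_def)
    then have "(\<lambda>j. a j x) \<longlonglongrightarrow> 0" by (rule summable_LIMSEQ_zero)
    then have "\<forall>\<^sub>F j in sequentially. a j x < 1" by (rule order_tendstoD) simp
    moreover have "\<forall>\<^sub>F j in sequentially. norm x \<le> real j"
      using eventually_ge_at_top[of "nat \<lceil>norm x\<rceil>"] by eventually_elim linarith
    ultimately have "\<forall>\<^sub>F j in sequentially. norm (d j x) \<le> 2 * (1 / 2) ^ j"
    proof eventually_elim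
      case (elim j)
      then have "G (2 ^ j * d j x) < 1" by (simp add: a_def)
      then have "\<bar>2 ^ j * d j x\<bar> \<le> 2" using abs_le_G[of "2 ^ j * d j x"] by simp
      then show ?case by (simp add: abs_mult power_divide field_simps)
    qed
    then have "summable (\<lambda>j. d j x)"
      by (rule summable_comparison_test_ev) (intro summable_mult summable_geometric, simp)
    then have "convergent (\<lambda>n. \<Sum>j<n. d j x)" by (simp add: summable_iff_convergent)
    moreover have "(\<Sum>j<n. d j x) = w (s n) x - w (s 0) x" for n
      unfolding d_def by (rule sum_lessThan_telescope)
    ultimately have "convergent (\<lambda>n. w (s n) x - w (s 0) x)" by simp
    from convergent_add[OF this convergent_const[of "w (s 0) x"]] show ?case by simp
  qed
  then have "AE x in lborel. (\<lambda>i. w (s i) x) \<longlonglongrightarrow> lim (\<lambda>i. w (s i) x)"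
    by (simp add: convergent_LIMSEQ_iff)
  moreover have "(\<lambda>x. lim (\<lambda>i. w (s i) x)) \<in> borel_measurable borel" by measurable
  ultimately show ?thesis using s(1) by blast
qed

end

section \<open>Compactness\<close>

text \<open>
  Dividing by the bounds reduces the claim to the case of one uniform bound.
\<close>

lemma bounded_on_countable_convergent_subseq:
  fixes f :: "nat \<Rightarrow> 'a :: countable \<Rightarrow> real"
  assumes f: "\<And>k x. \<bar>f k x\<bar> \<le> b x" and b: "\<And>x. 0 < b x"
  shows "\<exists>r :: nat \<Rightarrow> nat. \<exists>L. strict_mono r \<and> (\<forall>x. (\<lambda>j. f (r j) x) \<longlonglongrightarrow> L x)"
proof -
  have "norm (f k x / b x) \<le> 1" for k x using f[of k x] b[of x] by simp
  then obtain r where r: "strict_mono (r :: nat \<Rightarrow> nat)" "\<And>x. \<exists>l. (\<lambda>j. f (r j) x / b x) \<longlonglongrightarrow> l"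
    using function_convergent_subsequence[of UNIV "\<lambda>k x. f k x / b x" 1] by (metis UNIV_I countableI_type)
  then obtain l where l: "\<And>x. (\<lambda>j. f (r j) x / b x) \<longlonglongrightarrow> l x" by metis
  have "(\<lambda>j. f (r j) x) \<longlonglongrightarrow> l x * b x" for x
    using tendsto_mult_right[OF l[of x], of "b x"] b[of x] by simp
  then show ?thesis using r(1) by (intro exI[of _ r] exI[of _ "\<lambda>x. l x * b x"]) simp
qed

context young_growth
begin

text \<open>
  The difference of two members of the sequence is split through their step functions at a mesh \<open>h\<close>.
  The errors of the step functions are at most \<open>\<eta> b\<close>, uniformly in the sequence, and \<open>\<eta>\<close> tends to \<open>0\<close>
  with \<open>h\<close>. At a fixed mesh the step values on a cell are bounded in \<open>k\<close>, since their modular over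
  the cell is controlled by that of \<open>u\<close> and the error; a diagonal subsequence makes them converge on
  every cell and for every mesh, and a bounded set meets only finitely many cells.
\<close>

lemma exists_Cauchy_subseq:
  fixes u :: "nat \<Rightarrow> real ^ 'n \<Rightarrow> real" and b :: real
  assumes u [measurable]: "\<And>k. u k \<in> borel_measurable borel"
    and mono: "mono_on {0..} M" "mono_on {0..} N"
    and pos: "\<And>r. 0 < r \<Longrightarrow> 0 < M r \<and> 0 < N r"
    and M4: "cond_M4 CARD('n) pm M N"
    and b: "0 \<le> b" "\<And>k. modular_G G UNIV (u k) \<le> ennreal b" "\<And>k. modular_MNG M N G (u k) \<le> ennreal b"
  shows "\<exists>r :: nat \<Rightarrow> nat. strict_mono r \<and> (\<forall>K e. bounded K \<longrightarrow> 0 < e \<longrightarrow>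
    (\<exists>J. \<forall>i\<ge>J. \<forall>j\<ge>J. modular_G G K (\<lambda>x. u (r i) x - u (r j) x) \<le> ennreal e))"
proof -
  define n where "n = CARD('n)"
  \<comment> \<open>The mesh makes the cell diameter at most \<open>\<rho> \<le> 1\<close>, so that \<open>M\<close> is bounded there by \<open>M 1\<close>.\<close>
  define \<rho> h :: "nat \<Rightarrow> real" where "\<rho> m = 1 / (real m + 1)" and "h m = \<rho> m / real n" for m
  have n: "0 < n" by (simp add: n_def)
  have \<rho>: "0 < \<rho> m" "\<rho> m \<le> 1" and h: "0 < h m" "\<rho> m = real n * h m" for m
    using n by (simp_all add: \<rho>_def h_def)
  define \<eta> where "\<eta> m = max 1 (M 1) powr (pp - pm) * (N (\<rho> m) * M (\<rho> m) powr pm / h m ^ n)" for m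
  have \<eta>_nonneg: "0 \<le> \<eta> m" for m
    using pos[OF \<rho>(1)[of m]] h(1)[of m] unfolding \<eta>_def by (intro mult_nonneg_nonneg divide_nonneg_pos) auto
  have \<eta>: "\<eta> \<longlonglongrightarrow> 0"
  proof -
    \<comment> \<open>The hypothesis at the origin is stated with \<open>N (2 r)\<close> and \<open>M (2 r)\<close>, hence \<open>r = \<rho> / 2\<close>.\<close>
    have "filterlim (\<lambda>m. \<rho> m / 2) (at_right 0) sequentially"
      unfolding \<rho>_def by real_asymp
    with M4 have "((\<lambda>m. N (2 * (\<rho> m / 2)) * M (2 * (\<rho> m / 2)) powr pm / (\<rho> m / 2) ^ n) \<longlonglongrightarrow> 0)"
      unfolding cond_M4_def n_def by (rule filterlim_compose)
    then have "(\<lambda>m. max 1 (M 1) powr (pp - pm) * (real n / 2) ^ n * (N (2 * (\<rho> m / 2)) * M (2 * (\<rho> m / 2)) powr pm / (\<rho> m / 2) ^ n)) \<longlonglongrightarrow> 0"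
      by (rule tendsto_mult_right_zero)
    moreover have "max 1 (M 1) powr (pp - pm) * (real n / 2) ^ n * (N (2 * (\<rho> m / 2)) * M (2 * (\<rho> m / 2)) powr pm / (\<rho> m / 2) ^ n) = \<eta> m" for m
    proof -
      have "(real n / 2) ^ n * (y / (\<rho> m / 2) ^ n) = y / h m ^ n" for y
        using n \<rho>(1)[of m] by (simp add: h_def power_divide)
      then show ?thesis unfolding \<eta>_def mult.assoc by simp
    qed
    ultimately show ?thesis by simp
  qed
  define represents where "represents k m c \<longleftrightarrow> (\<forall>Z. finite Z \<longrightarrow>
      (\<Sum>z\<in>Z. modular_G G (cell (h m) z) (\<lambda>x. u k x - c z)) \<le> ennreal (\<eta> m) * modular_MNG M N G (u k))"
    for k m c
  define c where "c k m = (SOME c. represents k m c)" for k m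
  have "\<exists>c. represents k m c" for k m
    using exists_representatives[of "u k" M N "h m" "\<rho> m", OF u mono pos h(1) h(2)[unfolded n_def] \<rho>(2)]
    unfolding represents_def \<eta>_def n_def .
  then have "represents k m (c k m)" for k m
    unfolding c_def by (rule someI_ex)
  moreover have "ennreal (\<eta> m) * modular_MNG M N G (u k) \<le> ennreal (\<eta> m * b)" for k m
    using mult_left_mono[OF b(3), of "ennreal (\<eta> m)" k] \<eta>_nonneg[of m] by (simp add: ennreal_mult')
  ultimately have c: "\<And>k m Z. finite Z \<Longrightarrow>
      (\<Sum>z\<in>Z. modular_G G (cell (h m) z) (\<lambda>x. u k x - c k m z)) \<le> ennreal (\<eta> m * b)"
    unfolding represents_def using order_trans by blast
  define D where "D = 2 powr pp"
  have D: "0 < D" by (simp add: D_def)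
  have modular_const: "modular_G G (cell (h m) z :: (real ^ 'n) set) (\<lambda>x. t) = ennreal (h m ^ n * G t)" for m z t
    using emeasure_cell[OF h(1), of m z] h(1)[of m]
    by (simp add: modular_G_lborel nn_integral_cmult_indicator n_def ennreal_mult' mult.commute)

  \<comment> \<open>A bound on the step values that depends on the mesh but neither on \<open>k\<close> nor on the cell.\<close>
  define bd where "bd m = 1 + D * (\<eta> m * b + b) / h m ^ n" for m
  have bd: "0 < bd m" for m
    unfolding bd_def using D \<eta>_nonneg[of m] b(1) h(1)[of m] by (intro add_pos_nonneg) auto
  have c_bound: "\<bar>c k m z\<bar> \<le> bd m" for k m z
  proof -
    have "ennreal (h m ^ n * G (c k m z)) = modular_G G (cell (h m) z) (\<lambda>x. (c k m z - u k x) + u k x)"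
      by (simp add: modular_const)
    also have "\<dots> \<le> ennreal D * (modular_G G (cell (h m) z) (\<lambda>x. c k m z - u k x) + modular_G G (cell (h m) z) (u k))"
      unfolding D_def by (rule modular_add_le) auto
    also have "\<dots> \<le> ennreal D * (ennreal (\<eta> m * b) + ennreal b)"
    proof (intro mult_left_mono add_mono)
      have "modular_G G (cell (h m) z) (\<lambda>x. c k m z - u k x) = modular_G G (cell (h m) z) (\<lambda>x. u k x - c k m z)"
        unfolding modular_G_def by (subst G_even[symmetric]) simp
      then show "modular_G G (cell (h m) z) (\<lambda>x. c k m z - u k x) \<le> ennreal (\<eta> m * b)"
        using c[of "{z}" m k] by simp
      have "modular_G G (cell (h m) z) (u k) \<le> modular_G G UNIV (u k)"
        unfolding modular_G_def by (intro nn_integral_mono) (auto simp: indicator_def)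
      then show "modular_G G (cell (h m) z) (u k) \<le> ennreal b" using b(2) order_trans by blast
    qed auto
    also have "\<dots> = ennreal (D * (\<eta> m * b + b))"
      using D \<eta>_nonneg[of m] b(1) by (simp add: ennreal_mult' ennreal_plus)
    finally have "h m ^ n * G (c k m z) \<le> D * (\<eta> m * b + b)"
      using D \<eta>_nonneg[of m] b(1) by (subst (asm) ennreal_le_iff) auto
    then have "G (c k m z) \<le> D * (\<eta> m * b + b) / h m ^ n"
      using h(1)[of m] by (simp add: field_simps)
    then show ?thesis using abs_le_G[of "c k m z"] unfolding bd_def by linarith
  qed
  have "\<exists>r L. strict_mono (r :: nat \<Rightarrow> nat) \<and> (\<forall>p. (\<lambda>j. c (r j) (fst p) (snd p)) \<longlonglongrightarrow> L p)"
    by (rule bounded_on_countable_convergent_subseq[where b = "\<lambda>p. bd (fst p)"]) (auto intro: c_bound bd)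
  then obtain r and L where r: "strict_mono (r :: nat \<Rightarrow> nat)"
    and L: "\<And>m z. (\<lambda>j. c (r j) m z) \<longlonglongrightarrow> L (m, z)"
    by fastforce

  have three: "modular_G G (cell (h m) z) (\<lambda>x. u k x - u l x)
     \<le> ennreal D * (modular_G G (cell (h m) z) (\<lambda>x. u k x - c k m z)
        + ennreal D * (ennreal (h m ^ n * G (c k m z - c l m z)) + modular_G G (cell (h m) z) (\<lambda>x. u l x - c l m z)))"
    for k l m z
  proof -
    have "modular_G G (cell (h m) z) (\<lambda>x. u k x - u l x)
        = modular_G G (cell (h m) z) (\<lambda>x. (u k x - c k m z) + ((c k m z - c l m z) + (c l m z - u l x)))"
      by simp
    also have "\<dots> \<le> ennreal D * (modular_G G (cell (h m) z) (\<lambda>x. u k x - c k m z)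
       + modular_G G (cell (h m) z) (\<lambda>x. (c k m z - c l m z) + (c l m z - u l x)))"
      unfolding D_def by (rule modular_add_le) auto
    also have "\<dots> \<le> ennreal D * (modular_G G (cell (h m) z) (\<lambda>x. u k x - c k m z)
       + ennreal D * (modular_G G (cell (h m) z) (\<lambda>x. c k m z - c l m z) + modular_G G (cell (h m) z) (\<lambda>x. c l m z - u l x)))"
      unfolding D_def by (intro mult_left_mono add_left_mono modular_add_le) auto
    also have "modular_G G (cell (h m) z) (\<lambda>x. c l m z - u l x) = modular_G G (cell (h m) z) (\<lambda>x. u l x - c l m z)"
      unfolding modular_G_def by (subst G_even[symmetric]) simp
    finally show ?thesis by (simp add: modular_const)
  qed
  have "\<exists>J. \<forall>i\<ge>J. \<forall>j\<ge>J. modular_G G K (\<lambda>x. u (r i) x - u (r j) x) \<le> ennreal e"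
    if K: "bounded K" and e: "0 < e" for K e
  proof -
    have "(\<lambda>m. (D + D * D) * (\<eta> m * b)) \<longlonglongrightarrow> (D + D * D) * (0 * b)"
      by (intro tendsto_intros \<eta>)
    then have "\<forall>\<^sub>F m in sequentially. (D + D * D) * (\<eta> m * b) < e / 2"
      using e by (intro order_tendstoD) auto
    then obtain m where m: "(D + D * D) * (\<eta> m * b) < e / 2"
      by (auto simp: eventually_sequentially)
    define Z where "Z = {z. cell (h m) z \<inter> K \<noteq> {}}"
    have Z: "finite Z" unfolding Z_def by (rule finite_cells_meeting_bounded[OF K h(1)])
    have KZ: "K \<subseteq> (\<Union>z\<in>Z. cell (h m) z)"
      using mem_own_cell[of _ "h m"] by (fastforce simp: Z_def)
    define g where "g p = (\<Sum>z\<in>Z. h m ^ n * G (c (r (fst p)) m z - c (r (snd p)) m z))" for p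
    have "(g \<longlongrightarrow> (\<Sum>z\<in>Z. h m ^ n * G (L (m, z) - L (m, z)))) (sequentially \<times>\<^sub>F sequentially)"
      unfolding g_def
      by (intro tendsto_sum tendsto_mult_left tendsto_diff continuous_on_tendsto_compose[OF G_continuous]
          filterlim_compose[OF L filterlim_fst] filterlim_compose[OF L filterlim_snd]) auto
    then have "(g \<longlongrightarrow> 0) (sequentially \<times>\<^sub>F sequentially)" by simp
    then have "\<forall>\<^sub>F p in sequentially \<times>\<^sub>F sequentially. g p < e / (2 * (D * D))"
      using e D by (intro order_tendstoD) auto
    then obtain J where J: "\<And>i j. J \<le> i \<Longrightarrow> J \<le> j \<Longrightarrow> g (i, j) < e / (2 * (D * D))"
      unfolding eventually_prod_sequentially by blast
    have "modular_G G K (\<lambda>x. u (r i) x - u (r j) x) \<le> ennreal e" if ij: "J \<le> i" "J \<le> j" for i j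
    proof -
      have g_nonneg: "0 \<le> g (i, j)" using h(1)[of m] by (auto simp: g_def intro!: sum_nonneg)
      have "modular_G G K (\<lambda>x. u (r i) x - u (r j) x)
          \<le> (\<Sum>z\<in>Z. modular_G G (cell (h m) z) (\<lambda>x. u (r i) x - u (r j) x))"
        by (rule modular_le_sum_cells[OF _ Z KZ]) simp
      also have "\<dots> \<le> (\<Sum>z\<in>Z. ennreal D * (modular_G G (cell (h m) z) (\<lambda>x. u (r i) x - c (r i) m z)
          + ennreal D * (ennreal (h m ^ n * G (c (r i) m z - c (r j) m z))
            + modular_G G (cell (h m) z) (\<lambda>x. u (r j) x - c (r j) m z))))"
        by (intro sum_mono three)
      also have "\<dots> = ennreal D * ((\<Sum>z\<in>Z. modular_G G (cell (h m) z) (\<lambda>x. u (r i) x - c (r i) m z))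
          + ennreal D * (ennreal (g (i, j))
            + (\<Sum>z\<in>Z. modular_G G (cell (h m) z) (\<lambda>x. u (r j) x - c (r j) m z))))"
        using h(1)[of m] by (simp add: sum_distrib_left[symmetric] sum.distrib g_def sum_ennreal)
      also have "\<dots> \<le> ennreal D * (ennreal (\<eta> m * b) + ennreal D * (ennreal (g (i, j)) + ennreal (\<eta> m * b)))"
        by (intro mult_left_mono add_mono c[OF Z]) auto
      also have "\<dots> = ennreal (D * (\<eta> m * b + D * (g (i, j) + \<eta> m * b)))"
        using D b(1) \<eta>_nonneg[of m] g_nonneg by (simp add: ennreal_mult' ennreal_plus)
      also have "\<dots> \<le> ennreal e"
      proof (rule ennreal_leI)
        have "D * D * g (i, j) \<le> e / 2"
          using J[OF ij] D by (simp add: field_simps)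
        then show "D * (\<eta> m * b + D * (g (i, j) + \<eta> m * b)) \<le> e"
          using m by (simp add: algebra_simps)
      qed
      finally show ?thesis .
    qed
    then show ?thesis by blast
  qed
  then show ?thesis using r by blast
qed

text \<open>
  The pointwise limit is taken first and both modulars are bounded on it by Fatou's lemma. The same
  lemma, applied to \<open>w\<^sub>j - w\<^sub>i\<close> as \<open>i\<close> grows, turns the Cauchy property into convergence; scaling by
  \<open>1 / l\<close> costs a constant factor, so convergence of the modular gives convergence of the norm.
\<close>

lemma compact_embedding_Borel:
  fixes u :: "nat \<Rightarrow> real ^ 'n \<Rightarrow> real" and b :: real
  assumes u [measurable]: "\<And>k. u k \<in> borel_measurable borel"
    and mono: "mono_on {0..} M" "mono_on {0..} N"
    and pos: "\<And>r. 0 < r \<Longrightarrow> 0 < M r \<and> 0 < N r"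
    and M4: "cond_M4 CARD('n) pm M N"
    and b: "0 \<le> b" "\<And>k. modular_G G UNIV (u k) \<le> ennreal b" "\<And>k. modular_MNG M N G (u k) \<le> ennreal b"
  shows "\<exists>v \<in> W_space M N G. \<exists>k :: nat \<Rightarrow> nat. strict_mono k \<and>
           (\<forall>K. compact K \<longrightarrow> (\<lambda>j. luxemburg_norm G K (\<lambda>x. u (k j) x - v x)) \<longlonglongrightarrow> 0)"
proof -
  obtain r where r: "strict_mono (r :: nat \<Rightarrow> nat)"
    and Cauchy: "\<And>K e. bounded K \<Longrightarrow> 0 < e \<Longrightarrow>
      \<exists>J. \<forall>i\<ge>J. \<forall>j\<ge>J. modular_G G K (\<lambda>x. u (r i) x - u (r j) x) \<le> ennreal e"
    using exists_Cauchy_subseq[of u M N b, OF u mono pos M4 b] by auto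
  obtain s v where s: "strict_mono (s :: nat \<Rightarrow> nat)" and v [measurable]: "v \<in> borel_measurable borel"
    and lim: "AE x in lborel. (\<lambda>i. u (r (s i)) x) \<longlonglongrightarrow> v x"
    using Cauchy_imp_AE_convergent_subseq[of "\<lambda>i. u (r i)", OF u Cauchy] by auto
  define w where "w i = u (r (s i))" for i
  have w [measurable]: "w i \<in> borel_measurable borel" for i by (simp add: w_def)
  have w_lim: "AE x in lborel. (\<lambda>i. w i x) \<longlonglongrightarrow> v x" using lim by (simp add: w_def)
  have "modular_G G UNIV v \<le> ennreal b"
    by (rule modular_Fatou[OF w _ w_lim]) (auto simp: w_def b)
  moreover have "modular_MNG M N G v \<le> ennreal b"
    by (rule modular_MNG_Fatou[OF w mono w_lim]) (auto simp: w_def b)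
  moreover have "v \<in> borel_measurable lebesgue" by (rule measurable_completion) simp
  ultimately have "v \<in> W_space M N G"
    using le_less_trans[OF _ ennreal_less_top] by (auto simp: W_space_def orlicz_space_def)
  moreover have "(\<lambda>j. luxemburg_norm G K (\<lambda>x. w j x - v x)) \<longlonglongrightarrow> 0" if K: "compact K" for K
  proof (rule order_tendstoI)
    fix e :: ennreal assume "0 < e"
    then obtain y where y: "0 < y" "y < e" using dense by blast
    then have "y < top" using top.not_eq_extremum by fastforce
    then obtain l where l: "0 < l" "ennreal l < e"
      using y by (cases y) auto
    define a where "a = max 1 (1 / l)"
    have a: "1 \<le> a" "1 / l \<le> a" by (auto simp: a_def)
    have [measurable]: "K \<in> sets borel" using K by (simp add: borel_compact)
    obtain J where J: "\<And>i j. J \<le> i \<Longrightarrow> J \<le> j \<Longrightarrow>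
        modular_G G K (\<lambda>x. u (r i) x - u (r j) x) \<le> ennreal (1 / a powr pp)"
      using Cauchy[of K "1 / a powr pp"] K a by (auto simp: compact_imp_bounded)
    have "modular_G G K (\<lambda>x. (w j x - v x) / l) \<le> 1" if j: "J \<le> j" for j
    proof (rule modular_Fatou)
      show "AE x in lborel. (\<lambda>i. (w j x - w i x) / l) \<longlonglongrightarrow> (w j x - v x) / l"
        using w_lim by eventually_elim (use l in \<open>auto intro!: tendsto_intros\<close>)
      show "\<forall>\<^sub>F i in sequentially. modular_G G K (\<lambda>x. (w j x - w i x) / l) \<le> 1"
        using eventually_ge_at_top[of J]
      proof eventually_elim
        case (elim i)
        have "modular_G G K (\<lambda>x. (w j x - w i x) / l) \<le> modular_G G K (\<lambda>x. a * (w j x - w i x))"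
          unfolding modular_G_def
        proof (intro nn_integral_mono mult_right_mono ennreal_leI G_mono_abs)
          fix x
          have "1 / l * \<bar>w j x - w i x\<bar> \<le> a * \<bar>w j x - w i x\<bar>"
            using a by (intro mult_right_mono) auto
          then show "\<bar>(w j x - w i x) / l\<bar> \<le> \<bar>a * (w j x - w i x)\<bar>"
            using l a by (simp add: abs_mult)
        qed simp
        also have "\<dots> \<le> ennreal (a powr pp) * modular_G G K (\<lambda>x. w j x - w i x)"
          using a by (intro modular_scale_le) auto
        also have "\<dots> \<le> ennreal (a powr pp) * ennreal (1 / a powr pp)"
          unfolding w_def using j elim seq_suble[OF s, of i] seq_suble[OF s, of j]
          by (intro mult_left_mono J) auto
        also have "\<dots> = 1" using a by (simp add: ennreal_mult'[symmetric])
        finally show ?case .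
      qed
    qed auto
    then have "luxemburg_norm G K (\<lambda>x. w j x - v x) \<le> ennreal l" if "J \<le> j" for j
      unfolding luxemburg_norm_def using that l by (intro INF_lower) auto
    then show "\<forall>\<^sub>F j in sequentially. luxemburg_norm G K (\<lambda>x. w j x - v x) < e"
      using l by (auto simp: eventually_sequentially intro: le_less_trans)
  qed simp
  moreover have "strict_mono (\<lambda>i. r (s i))" using r s by (simp add: strict_mono_def)
  ultimately show ?thesis by (auto simp: w_def intro!: bexI[of _ v] exI[of _ "\<lambda>i. r (s i)"])
qed

end

section \<open>From Lebesgue to Borel measurable functions\<close>

lemma modular_G_cong_AE:
  assumes "AE x in lborel. u x = u' x"
  shows "modular_G G A u = modular_G G A u'"
  unfolding modular_G_lborel using assms by (intro nn_integral_cong_AE) (auto elim: eventually_mono)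

lemma modular_MNG_cong_AE:
  assumes "AE x in lborel. u x = u' x"
  shows "modular_MNG M N G u = modular_MNG M N G u'"
  unfolding modular_MNG_lborel
  using AE_pair_both[OF sigma_finite_lborel assms]
  by (intro nn_integral_cong_AE) (auto elim: eventually_mono)

theorem theorem4p2:
  fixes G M N :: "real \<Rightarrow> real"
    and pm pp :: real
    and u :: "nat \<Rightarrow> real ^ 'n \<Rightarrow> real"
  assumes G_young: "young_function G"
    and G_growth: "growth_condition G pm pp"
    and M_nonneg: "M \<in> {0..} \<rightarrow> {0..}"
    and N_nonneg: "N \<in> {0..} \<rightarrow> {0..}"
    and M1: "cond_M1 M N"
    and M2: "cond_M2 M N"
    and M3: "cond_M3 CARD('n) pm M N"
    and M4: "cond_M4 CARD('n) pm M N"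
    and u_in_W: "\<And>k. u k \<in> W_space M N G"
    and u_bounded: "(SUP k. modular_MNG M N G (u k) + modular_G G UNIV (u k)) < \<infinity>"
  shows "\<exists>v \<in> W_space M N G. \<exists>k :: nat \<Rightarrow> nat. strict_mono k \<and>
           (\<forall>K. compact K \<longrightarrow>
              (\<lambda>j. luxemburg_norm G K (\<lambda>x. u (k j) x - v x)) \<longlonglongrightarrow> 0)"
proof -
  interpret young_growth G pm pp using G_young G_growth by unfold_locales
  have "\<exists>f\<in>borel_measurable borel. AE x in lborel. u k x = f x" for k
    using completion_ex_borel_measurable_real[of "u k" lborel] u_in_W[of k]
    by (simp add: W_space_def orlicz_space_def)
  then obtain f where f: "\<And>k. f k \<in> borel_measurable borel" "\<And>k. AE x in lborel. u k x = f k x"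
    by metis
  obtain b where b: "0 \<le> b" "(SUP k. modular_MNG M N G (u k) + modular_G G UNIV (u k)) = ennreal b"
    using u_bounded by (cases "SUP k. modular_MNG M N G (u k) + modular_G G UNIV (u k)") auto
  have le: "modular_MNG M N G (u k) + modular_G G UNIV (u k) \<le> ennreal b" for k
    unfolding b(2)[symmetric] by (rule SUP_upper) simp
  have "modular_G G UNIV (f k) \<le> ennreal b" "modular_MNG M N G (f k) \<le> ennreal b" for k
    using le[of k] modular_G_cong_AE[OF f(2), of G UNIV k] modular_MNG_cong_AE[OF f(2), of M N G k]
    by (auto intro: order_trans[rotated] simp: add_increasing add_increasing2)
  then have "\<exists>v \<in> W_space M N G. \<exists>k :: nat \<Rightarrow> nat. strict_mono k \<and>
      (\<forall>K. compact K \<longrightarrow> (\<lambda>j. luxemburg_norm G K (\<lambda>x. f (k j) x - v x)) \<longlonglongrightarrow> 0)"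
    using M1 f(1) b(1) M4 unfolding cond_M1_def
    by (intro compact_embedding_Borel[of f M N b]) auto
  moreover have "luxemburg_norm G K (\<lambda>x. f k x - v x) = luxemburg_norm G K (\<lambda>x. u k x - v x)" for K k v
  proof -
    have "modular_G G K (\<lambda>x. (f k x - v x) / l) = modular_G G K (\<lambda>x. (u k x - v x) / l)" for l
      by (rule modular_G_cong_AE) (use f(2)[of k] in eventually_elim, simp)
    then show ?thesis by (simp add: luxemburg_norm_def)
  qed
  ultimately show ?thesis by simp
qed

end
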